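(* Let $m$ and $r$ be integers with $1\leq r\leq m-3$, and let $PS(r,m-r)$ be the path-star graph of order $m$ (defined in the context). Then every 2-connected graph $G$ with minimum degree $\delta(G)\geq m+2$ contains a subgraph $T$ isomorphic to $PS(r,m-r)$ such that $G-V(T)$ is 2-connected.
   Context: All graphs are finite, simple (no loops, no multiple edges). A graph is 2-connected if its vertex-connectivity is at least 2. For $U\subseteq V(G)$, $G-U$ is the subgraph induced by $V(G)\setminus U$. A star is a tree that has exactly one vertex of degree greater than one. The path-star graph $PS(r,m-r)$ is obtained from the disjoint union of a path of order $r+1$ and a star of order $m-r$ by identifying one end vertex of the path with one vertex of degree one of the star; it has order $m$. *)

theory Defs
  imports "Graph_Theory.Graph_Theory"
begin

text \<open>
  Finite simple graphs are the locale \<open>graph\<close> of the session Graph_Theory: finite, loop-free,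
  symmetric digraphs without parallel arcs. An undirected edge is a pair of opposite arcs, so
  the degree of a vertex is its out-degree.
\<close>

definition min_degree :: "('a, 'b) pre_digraph \<Rightarrow> nat" where
  "min_degree G = Min (out_degree G ` verts G)"

text \<open>
  The least number of vertices whose deletion leaves a disconnected graph or at most one vertex;
  hence the connectivity of a complete graph of order \<open>n \<ge> 1\<close> is \<open>n - 1\<close>.
\<close>

definition vertex_connectivity :: "('a, 'b) pre_digraph \<Rightarrow> nat" where
  "vertex_connectivity G =
    (LEAST k. \<exists>S \<subseteq> verts G. card S = k \<and>
      (\<not> connected (G \<restriction> (verts G - S)) \<or> card (verts G - S) \<le> 1))"

definition two_connected :: "('a, 'b) pre_digraph \<Rightarrow> bool" where
  "two_connected G \<longleftrightarrow> vertex_connectivity G \<ge> 2"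

definition path_graph :: "nat \<Rightarrow> nat pair_pre_digraph" where
  "path_graph n =
    \<lparr> pverts = {..<n}, parcs = {(i, j). i < n \<and> j < n \<and> (j = Suc i \<or> i = Suc j)} \<rparr>"

text \<open>The star with centre \<open>c\<close> and set of leaves \<open>L\<close>, where \<open>c \<notin> L\<close>.\<close>

definition star_graph :: "'a \<Rightarrow> 'a set \<Rightarrow> 'a pair_pre_digraph" where
  "star_graph c L = \<lparr> pverts = insert c L, parcs = {c} \<times> L \<union> L \<times> {c} \<rparr>"

text \<open>
  \<open>PS(r, s)\<close>, of order \<open>r + s\<close>: the path \<open>0, \<dots>, r\<close> of order \<open>r + 1\<close> and a star of order \<open>s\<close>
  on \<open>{r..<r + s}\<close> with centre \<open>r + 1\<close>. They share exactly the vertex \<open>r\<close>, which is an end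
  of the path and a leaf of the star. Meaningful for \<open>s \<ge> 3\<close>.
\<close>

definition path_star :: "nat \<Rightarrow> nat \<Rightarrow> (nat, nat \<times> nat) pre_digraph" where
  "path_star r s =
    union (with_proj (path_graph (r + 1)))
      (with_proj (star_graph (r + 1) ({r..<r + s} - {r + 1})))"

lemma verts_path_star: "s \<ge> 2 \<Longrightarrow> verts (path_star r s) = {..<r + s}"
  by (auto simp: path_star_def path_graph_def star_graph_def)

lemma graph_path_star: "graph (path_star r s)"
  by unfold_locales
    (auto simp: path_star_def union_def path_graph_def star_graph_def symmetric_def sym_def
      arcs_ends_def arc_to_ends_def image_iff
      intro: finite_subset[of _ "{..<r + 1} \<times> {..<r + 1}"])

end

theory Submission
  imports Defs
begin

text \<open>
  Among all pairs of a copy \<open>T\<close> of the path-star and a nonseparable set \<open>B\<close> of at least two vertices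
  disjoint from \<open>T\<close>, take one with \<open>B\<close> as large as possible, and suppose that some vertices lie
  outside \<open>B\<close> and \<open>T\<close>. Let \<open>A\<close> be the set of vertices outside \<open>B\<close> with two neighbours in \<open>B\<close>.

  If \<open>A\<close> is empty, let \<open>P\<close> be a shortest ear of \<open>B\<close>. Every vertex outside \<open>B\<close> and \<open>P\<close> has at most three
  neighbours in \<open>B \<union> P\<close>, so the remaining vertices induce minimum degree at least \<open>m - 1\<close> and
  contain a path-star, while \<open>B \<union> P\<close> is nonseparable and larger than \<open>B\<close>.

  Otherwise \<open>A\<close> is contained in \<open>T\<close>, and it suffices to find a path-star outside \<open>B\<close> that avoids some
  \<open>a \<in> A\<close>. Let \<open>Q\<close> be a longest path outside \<open>B\<close> and \<open>T\<close>. With \<open>k\<close> its number of vertices, each end of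
  \<open>Q\<close> is adjacent to all but at most \<open>k - 2\<close> vertices of \<open>T\<close>. Hence \<open>Q\<close>, in one of its two directions,
  can be spliced into the path of \<open>T\<close> around \<open>a\<close>, bypassing at most \<open>k - 2\<close> vertices besides \<open>a\<close>.
  The resulting path is long enough; its star is centred at the old centre, or at an end of \<open>Q\<close>
  when the old centre is bypassed.
\<close>

section \<open>Adjacency relations: connectedness, paths and ears\<close>

locale simple_adjacency =
  fixes V :: "'a set" and E :: "'a \<Rightarrow> 'a \<Rightarrow> bool"
  assumes finite_V: "finite V"
    and E_sym: "E x y \<Longrightarrow> E y x"
    and E_irrefl: "\<not> E x x"
    and E_V: "E x y \<Longrightarrow> y \<in> V"
begin

definition nbrs :: "'a \<Rightarrow> 'a set" where
  "nbrs v = {w. E v w}"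

text \<open>Connectedness is expressed by edge cuts, which needs no walks. The empty set and
  singletons count as connected.\<close>

definition conn :: "'a set \<Rightarrow> bool" where
  "conn W \<longleftrightarrow> (\<forall>X \<subseteq> W. X \<noteq> {} \<longrightarrow> X \<noteq> W \<longrightarrow> (\<exists>x\<in>X. \<exists>y\<in>W - X. E x y))"

text \<open>There is no lower bound on the size, so a single edge can start the extremal argument.
  From three vertices on this is 2-connectivity.\<close>

definition nonseparable :: "'a set \<Rightarrow> bool" where
  "nonseparable W \<longleftrightarrow> conn W \<and> (\<forall>x. conn (W - {x}))"

definition path_in :: "'a set \<Rightarrow> 'a list \<Rightarrow> bool" where
  "path_in W xs \<longleftrightarrow> xs \<noteq> [] \<and> distinct xs \<and> successively E xs \<and> set xs \<subseteq> W"

text \<open>Only the inner vertices are listed, and they may repeat, so rerouting an ear requires no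
  check of disjointness. A shortest ear turns out to be free of repetitions.\<close>

definition ear :: "'a set \<Rightarrow> 'a list \<Rightarrow> bool" where
  "ear B P \<longleftrightarrow> P \<noteq> [] \<and> successively E P \<and> set P \<subseteq> V - B \<and>
    (\<exists>b\<in>B. \<exists>b'\<in>B. b \<noteq> b' \<and> E b (hd P) \<and> E (last P) b')"

text \<open>The path is listed starting from the centre of the star.\<close>

definition path_star_in :: "nat \<Rightarrow> nat \<Rightarrow> 'a set \<Rightarrow> 'a list \<Rightarrow> 'a set \<Rightarrow> bool" where
  "path_star_in m r W cs L \<longleftrightarrow> path_in W cs \<and> length cs = r + 2 \<and>
    L \<subseteq> W - set cs \<and> L \<subseteq> nbrs (hd cs) \<and> finite L \<and> card L = m - r - 2"

lemma earI:
  assumes "P \<noteq> []" "successively E P" "set P \<subseteq> V - B"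
    and "b \<in> B" "b' \<in> B" "b \<noteq> b'" "E b (hd P)" "E (last P) b'"
  shows "ear B P"
  using assms unfolding ear_def by blast

lemma finite_nbrs [simp]: "finite (nbrs v)"
  using finite_V by (rule finite_subset[rotated]) (auto simp: nbrs_def E_V)

lemma successively_E_flip [simp]: "successively (\<lambda>x y. E y x) xs \<longleftrightarrow> successively E xs"
proof -
  have "(\<lambda>x y. E y x) = E" by (blast intro: E_sym)
  then show ?thesis by (rule arg_cong[where f = "\<lambda>R. successively R xs"])
qed

lemma path_in_rev: "path_in W (rev xs) \<longleftrightarrow> path_in W xs"
  by (simp add: path_in_def)

lemma path_in_take: "path_in W xs \<Longrightarrow> 0 < n \<Longrightarrow> path_in W (take n xs)"
  unfolding path_in_def
  by (metis append_take_drop_id distinct_take order.trans set_take_subset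
      successively_append_iff take_eq_Nil2 less_irrefl)

lemma path_in_length: "path_in W xs \<Longrightarrow> finite W \<Longrightarrow> length xs \<le> card W"
  unfolding path_in_def by (metis card_mono distinct_card)

section \<open>Attaching ears to nonseparable sets\<close>

lemma conn_insert:
  assumes "conn W" "b \<in> W" "E b x"
  shows "conn (insert x W)"
  unfolding conn_def
proof (intro allI impI)
  fix X assume X: "X \<subseteq> insert x W" "X \<noteq> {}" "X \<noteq> insert x W"
  show "\<exists>u\<in>X. \<exists>v\<in>insert x W - X. E u v"
  proof (cases "x \<in> W")
    case True
    then show ?thesis using X assms(1) unfolding conn_def by (metis insert_absorb)
  next
    case False
    consider "X \<inter> W = {}" | "W \<subseteq> X" | "X \<inter> W \<noteq> {}" "X \<inter> W \<noteq> W" by blast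
    then show ?thesis
    proof cases
      case 1
      then have "X = {x}" using X by blast
      then show ?thesis using assms E_sym False by blast
    next
      case 2
      then have "X = W" using X by blast
      then show ?thesis using assms False by blast
    next
      case 3
      then obtain u v where "u \<in> X \<inter> W" "v \<in> W - X \<inter> W" "E u v"
        using assms(1) unfolding conn_def by (metis inf_le2)
      then show ?thesis by blast
    qed
  qed
qed

lemma conn_attach:
  "conn W \<Longrightarrow> b \<in> W \<Longrightarrow> successively E (b # xs) \<Longrightarrow> conn (W \<union> set xs)"
proof (induction xs arbitrary: b W)
  case (Cons x xs)
  have "conn (insert x W \<union> set xs)"
    using Cons.prems by (intro Cons.IH[of _ x]) (auto intro: conn_insert)
  then show ?case by simp
qed simp

text \<open>Let \<open>C\<close> collect the ends of walks from \<open>x\<close> inside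
  \<open>U - B\<close>. Some edge of \<open>U\<close> leaves \<open>C\<close>, and its far end must
  lie in \<open>B\<close>, since otherwise the walk could be prolonged.\<close>

lemma conn_exit:
  assumes "conn U" "x \<in> U - B" "U \<inter> B \<noteq> {}"
  shows "\<exists>P b. P \<noteq> [] \<and> successively E P \<and> set P \<subseteq> U - B \<and> hd P = x \<and> b \<in> U \<inter> B \<and> E (last P) b"
proof -
  define C where "C = {last P | P. P \<noteq> [] \<and> successively E P \<and> set P \<subseteq> U - B \<and> hd P = x}"
  have "x \<in> C" using assms(2) by (auto simp: C_def intro!: exI[of _ "[x]"])
  moreover have CU: "C \<subseteq> U - B" by (auto simp: C_def dest!: last_in_set)
  ultimately obtain c w where cw: "c \<in> C" "w \<in> U - C" "E c w"
    using assms unfolding conn_def by blast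
  then obtain P where P: "P \<noteq> []" "successively E P" "set P \<subseteq> U - B" "hd P = x" "last P = c"
    by (auto simp: C_def)
  have "w \<in> B"
  proof (rule ccontr)
    assume "w \<notin> B"
    then have "last (P @ [w]) \<in> C"
      using P cw unfolding C_def
      by (intro CollectI exI[of _ "P @ [w]"]) (auto simp: successively_append_iff)
    then show False using cw by simp
  qed
  then show ?thesis using P cw by blast
qed

text \<open>\<open>conn_exit\<close> is applied twice. In \<open>V\<close> it yields a vertex
  outside \<open>B\<close> adjacent to some \<open>b\<close> in \<open>B\<close>; in
  \<open>V - {b}\<close> it leads from that vertex to some \<open>c\<close> in \<open>B\<close>
  other than \<open>b\<close>. The second walk is an ear between \<open>b\<close> and
  \<open>c\<close>.\<close>

lemma ear_exists:
  assumes "nonseparable V" "B \<subseteq> V" "B \<noteq> V" "card B \<ge> 2"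
  shows "\<exists>P. ear B P"
proof -
  obtain x where x: "x \<in> V - B" using assms by blast
  have "V \<inter> B \<noteq> {}" using assms(2,4) by (auto simp: Int_absorb1)
  then obtain P b where P: "P \<noteq> []" "set P \<subseteq> V - B" "b \<in> B" "E (last P) b"
    using conn_exit[OF _ x] assms(1) unfolding nonseparable_def by blast
  obtain b' where b': "b' \<in> B" "b' \<noteq> b"
    using assms(4) card_mono[of "{b}" B] by fastforce
  have l: "last P \<in> (V - {b}) - B" using P last_in_set[of P] by blast
  have "(V - {b}) \<inter> B \<noteq> {}" using b' assms by blast
  then obtain Q c where Q: "Q \<noteq> []" "successively E Q" "set Q \<subseteq> V - {b} - B" "hd Q = last P"
      "c \<in> (V - {b}) \<inter> B" "E (last Q) c"
    using conn_exit[OF _ l] assms(1) unfolding nonseparable_def by metis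
  have "E b (hd Q)" using Q(4) P(4) by (simp add: E_sym)
  with Q P(3) have "ear B Q" by (intro earI[where b = b and b' = c]) auto
  then show ?thesis ..
qed

text \<open>Deleting an ear vertex leaves two pieces, one hanging on \<open>b\<close> and one on
  \<open>b'\<close>. Deleting any other vertex spares \<open>b\<close> or \<open>b'\<close>, and the
  whole ear hangs on the survivor.\<close>

lemma nonseparable_ear:
  assumes B: "nonseparable B" "ear B P" "distinct P"
  shows "nonseparable (B \<union> set P)"
proof -
  from B obtain b b' where P: "P \<noteq> []" "successively E P" "set P \<inter> B = {}" "b \<in> B" "b' \<in> B"
      "b \<noteq> b'" "E b (hd P)" "E (last P) b'"
    unfolding ear_def by blast
  have fwd: "successively E (b # P)" using P by (cases P) auto
  have bwd: "successively E (b' # rev P)"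
    using P E_sym by (auto simp: successively_Cons hd_rev)
  have "conn (B \<union> set P - {x})" for x
  proof -
    consider "x \<in> set P" | "x \<notin> set P" "x \<noteq> b" | "x \<notin> set P" "x \<noteq> b'" using P by blast
    then show ?thesis
    proof cases
      case 1
      then obtain ys zs where split: "P = ys @ x # zs" by (meson split_list)
      have "successively E (b # ys)"
        using fwd split by (metis append_Cons successively_append_iff)
      then have "conn (B \<union> set ys)"
        using B(1) P unfolding nonseparable_def by (blast intro: conn_attach)
      moreover have "b' # rev P = (b' # rev zs) @ x # rev ys" using split by simp
      then have "successively E (b' # rev zs)" using bwd by (metis successively_append_iff)
      ultimately have "conn ((B \<union> set ys) \<union> set (rev zs))"
        using P by (intro conn_attach[of "B \<union> set ys" b']) blast+
      \<comment> \<open>Distinctness of \<open>P\<close> matters here: \<open>x\<close> occurs in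
        neither \<open>ys\<close> nor \<open>zs\<close>.\<close>
      moreover have "B \<union> set P - {x} = (B \<union> set ys) \<union> set (rev zs)"
        using split B(3) P(3) by auto
      ultimately show ?thesis by simp
    next
      case 2
      have "conn ((B - {x}) \<union> set P)"
        using B(1) P 2 fwd unfolding nonseparable_def by (intro conn_attach[of _ b]) auto
      moreover have "B \<union> set P - {x} = (B - {x}) \<union> set P" using 2 by blast
      ultimately show ?thesis by simp
    next
      case 3
      have "conn ((B - {x}) \<union> set (rev P))"
        using B(1) P 3 bwd unfolding nonseparable_def by (intro conn_attach[of _ b']) auto
      moreover have "B \<union> set P - {x} = (B - {x}) \<union> set (rev P)" using 3 by auto
      ultimately show ?thesis by simp
    qed
  qed
  moreover have "conn (B \<union> set P)"
    using B(1) P fwd unfolding nonseparable_def by (blast intro: conn_attach)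
  ultimately show ?thesis by (simp add: nonseparable_def)
qed

section \<open>Path-stars from long paths and minimum degree\<close>

text \<open>The first \<open>r + 2\<close> vertices form the path. The head is not its own
  neighbour, so at most \<open>r + 1\<close> of its \<open>m - 1\<close> neighbours lie on the path,
  which leaves \<open>m - r - 2\<close> leaves.\<close>

lemma path_star_in_if_path:
  assumes "finite W" "path_in W xs" "r + 2 \<le> length xs" "r + 3 \<le> m"
    and "m - 1 \<le> card (nbrs (hd xs) \<inter> W)"
  shows "\<exists>cs L. path_star_in m r W cs L"
proof -
  define cs where "cs = take (r + 2) xs"
  have cs: "path_in W cs" "length cs = r + 2"
    using assms by (auto simp: cs_def intro: path_in_take)
  have hd: "hd cs = hd xs" by (simp add: cs_def)
  have ne: "cs \<noteq> []" using cs by (simp add: path_in_def)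
  have "nbrs (hd cs) \<inter> set cs \<subseteq> set (tl cs)"
    using ne E_irrefl by (cases cs) (auto simp: nbrs_def)
  then have "card (nbrs (hd cs) \<inter> set cs) \<le> r + 1"
    using cs by (metis List.finite_set add_diff_cancel_right' card_length card_mono length_tl
        order.trans add.assoc one_add_one nat_1_add_1)
  moreover have "card (nbrs (hd cs) \<inter> W)
      \<le> card (nbrs (hd cs) \<inter> W - set cs) + card (nbrs (hd cs) \<inter> set cs)"
    by (rule order.trans[OF card_mono card_Un_le]) auto
  ultimately have "m - r - 2 \<le> card (nbrs (hd cs) \<inter> W - set cs)"
    using assms hd by simp
  then obtain L where "L \<subseteq> nbrs (hd cs) \<inter> W - set cs" "card L = m - r - 2" "finite L"
    by (meson obtain_subset_with_card_n)
  then have "path_star_in m r W cs L" using cs by (auto simp: path_star_in_def)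
  then show ?thesis by blast
qed

lemma path_in_longest:
  assumes "finite W" "W \<noteq> {}"
  shows "\<exists>P. path_in W P \<and> (\<forall>Q. path_in W Q \<longrightarrow> length Q \<le> length P)"
proof -
  obtain x where "x \<in> W" using assms by blast
  then have "path_in W [x]" by (simp add: path_in_def)
  then show ?thesis
    using ex_has_greatest_nat[of "path_in W" _ length "Suc (card W)"] path_in_length assms
    by (metis le_imp_less_Suc)
qed

text \<open>A neighbour of the first vertex off the path could be prepended.\<close>

lemma longest_path_hd_nbrs:
  assumes "path_in W P" "\<forall>Q. path_in W Q \<longrightarrow> length Q \<le> length P"
  shows "nbrs (hd P) \<inter> W \<subseteq> set (tl P)"
proof
  fix x assume x: "x \<in> nbrs (hd P) \<inter> W"
  have "\<not> path_in W (x # P)" using assms(2) by (metis length_Cons Suc_n_not_le_n)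
  then have "x \<in> set P"
    using assms(1) x E_sym by (auto simp: path_in_def successively_Cons nbrs_def)
  then show "x \<in> set (tl P)"
    using x E_irrefl by (cases P) (auto simp: nbrs_def)
qed

lemma longest_path_card_nbrs:
  assumes "path_in W P" "\<forall>Q. path_in W Q \<longrightarrow> length Q \<le> length P"
  shows "card (nbrs (hd P) \<inter> W) < length P"
proof -
  have "card (nbrs (hd P) \<inter> W) \<le> length (tl P)"
    using longest_path_hd_nbrs[OF assms] by (meson List.finite_set card_length card_mono order.trans)
  then show ?thesis using assms(1) by (cases P) (auto simp: path_in_def)
qed

text \<open>A longest path contains all neighbours of its first vertex within \<open>W\<close>, so
  it has at least \<open>m\<close> vertices, and its first vertex can be the centre.\<close>

lemma path_star_in_if_min_degree:
  assumes "finite W" "W \<noteq> {}" "r + 3 \<le> m" "\<And>v. v \<in> W \<Longrightarrow> m - 1 \<le> card (nbrs v \<inter> W)"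
  shows "\<exists>cs L. path_star_in m r W cs L"
proof -
  obtain P where P: "path_in W P" "\<forall>Q. path_in W Q \<longrightarrow> length Q \<le> length P"
    using path_in_longest[OF assms(1,2)] by metis
  have "hd P \<in> W" using P(1) by (cases P) (auto simp: path_in_def)
  then have "m - 1 \<le> card (nbrs (hd P) \<inter> W)" using assms by blast
  moreover from this have "r + 2 \<le> length P"
    using longest_path_card_nbrs[OF P] assms(3) by linarith
  ultimately show ?thesis using path_star_in_if_path assms P by blast
qed

section \<open>Shortest ears\<close>

text \<open>Cutting out the segment between two occurrences of a vertex preserves both ends and
  gives a shorter ear.\<close>

lemma shortest_ear_distinct:
  assumes "ear B P" "\<And>Q. ear B Q \<Longrightarrow> length P \<le> length Q"
  shows "distinct P"
proof (rule ccontr)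
  assume "\<not> distinct P"
  then obtain xs ys zs y where split: "P = xs @ [y] @ ys @ [y] @ zs"
    using not_distinct_decomp by blast
  have "ear B (xs @ [y] @ zs)"
    using assms(1) unfolding ear_def split
    by (auto simp: successively_append_iff successively_Cons hd_append split: if_splits)
  from assms(2)[OF this] split show False by simp
qed

text \<open>Rerouting the ear through \<open>v\<close> must not shorten it, so the neighbours of
  \<open>v\<close> on \<open>P\<close> lie within three consecutive positions. A neighbour in
  \<open>B\<close> offers a further shortcut and reduces this to the first two or the last two
  positions.\<close>

lemma shortest_ear_nbrs:
  assumes P: "ear B P" "\<And>Q. ear B Q \<Longrightarrow> length P \<le> length Q"
    and v: "v \<in> V - B" "card (nbrs v \<inter> B) \<le> 1"
  shows "card (nbrs v \<inter> (B \<union> set P)) \<le> 3"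
proof -
  obtain b b' where b: "P \<noteq> []" "successively E P" "set P \<subseteq> V - B" "b \<in> B" "b' \<in> B"
      "b \<noteq> b'" "E b (hd P)" "E (last P) b'"
    using P(1) unfolding ear_def by blast
  define I where "I = {i. i < length P \<and> E v (P ! i)}"
  have img: "nbrs v \<inter> set P = (!) P ` I"
    by (auto simp: I_def nbrs_def in_set_conv_nth)
  have fI: "finite I" by (simp add: I_def)
  have split: "successively E (take i P)" "successively E (drop i P)" for i
    using b(2) by (metis append_take_drop_id successively_append_iff)+
  have sub: "set (take i P) \<subseteq> V - B" "set (drop i P) \<subseteq> V - B" for i
    using b(3) set_take_subset[of i P] set_drop_subset[of i P] by blast+
  have last_take: "last (take (Suc i) P) = P ! i" if "i < length P" for i
    using that by (simp add: take_Suc_conv_app_nth)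
  have down: "v # drop i P \<noteq> [] \<and> successively E (v # drop i P) \<and> set (v # drop i P) \<subseteq> V - B
      \<and> E (last (v # drop i P)) b'" if "i \<in> I" for i
    using that split sub v b by (auto simp: I_def successively_Cons hd_drop_conv_nth)
  have up: "take (Suc i) P @ [v] \<noteq> [] \<and> successively E (take (Suc i) P @ [v]) \<and>
      set (take (Suc i) P @ [v]) \<subseteq> V - B \<and> E b (hd (take (Suc i) P @ [v]))" if "i \<in> I" for i
    using that split[of "Suc i"] sub(1)[of "Suc i"] v b last_take E_sym
    by (auto simp: I_def successively_append_iff hd_append)
  \<comment> \<open>The detour from position \<open>i\<close> through \<open>v\<close> to position
    \<open>j\<close> has \<open>i + 2 + (length P - j)\<close> vertices.\<close>
  have spread: "j \<le> i + 2" if "i \<in> I" "j \<in> I" for i j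
  proof -
    have "ear B (take (Suc i) P @ v # drop j P)"
    proof (rule earI[where b = b and b' = b'])
      show "successively E (take (Suc i) P @ v # drop j P)"
        using up[OF that(1)] down[OF that(2)] by (auto simp: successively_append_iff)
      show "set (take (Suc i) P @ v # drop j P) \<subseteq> V - B"
        using up[OF that(1)] down[OF that(2)] by auto
    qed (use b down[OF that(2)] in auto)
    from P(2)[OF this] show ?thesis using that by (auto simp: I_def)
  qed
  show ?thesis
  proof (cases "nbrs v \<inter> B = {}")
    case True
    have "card I \<le> 3"
    proof (cases "I = {}")
      case False
      have "I \<subseteq> {Min I..Min I + 2}" using spread[OF Min_in[OF fI False]] fI by auto
      then show ?thesis using card_mono[of "{Min I..Min I + 2}" I] by simp
    qed simp
    then have "card (nbrs v \<inter> set P) \<le> 3" unfolding img using card_image_le[OF fI] by (meson order.trans)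
    moreover have "nbrs v \<inter> (B \<union> set P) = nbrs v \<inter> set P" using True by blast
    ultimately show ?thesis by simp
  next
    case False
    then obtain c where c: "c \<in> B" "E v c" by (auto simp: nbrs_def)
    \<comment> \<open>If \<open>c\<close> differs from \<open>b'\<close>, an ear can enter through
      \<open>v\<close> and skip everything before position \<open>i\<close>. If
      \<open>c = b'\<close>, it can leave through \<open>v\<close> and skip everything after
      position \<open>i\<close>.\<close>
    have "card I \<le> 2"
    proof (cases "c = b'")
      case False
      have "i \<le> 1" if "i \<in> I" for i
      proof -
        have "ear B (v # drop i P)"
          using down[OF that] c b(5) False E_sym[OF c(2)] by (intro earI[where b = c and b' = b']) auto
        from P(2)[OF this] show ?thesis using that by (auto simp: I_def)
      qed
      then have "I \<subseteq> {0..1}" by auto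
      then show ?thesis using card_mono[of "{0..1}" I] by simp
    next
      case True
      have "length P \<le> i + 2" if "i \<in> I" for i
      proof -
        have "ear B (take (Suc i) P @ [v])"
          using up[OF that] c b(4,6) True by (intro earI[where b = b and b' = c]) auto
        from P(2)[OF this] show ?thesis using that by (auto simp: I_def)
      qed
      then have "I \<subseteq> {length P - 2..<length P}" by (auto simp: I_def le_diff_conv)
      then show ?thesis using card_mono[of "{length P - 2..<length P}" I] by simp
    qed
    then have "card (nbrs v \<inter> set P) \<le> 2" unfolding img using card_image_le[OF fI] by (meson order.trans)
    moreover have "card (nbrs v \<inter> (B \<union> set P)) \<le> card (nbrs v \<inter> B) + card (nbrs v \<inter> set P)"
      unfolding Int_Un_distrib by (rule card_Un_le)
    ultimately show ?thesis using v by linarith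
  qed
qed

text \<open>Jumping from the head directly to a neighbour at position \<open>i\<close> saves
  \<open>i - 1\<close> vertices. This is used to show that a shortest ear does not exhaust the rest
  of the graph.\<close>

lemma shortest_ear_hd_nbrs:
  assumes P: "ear B P" "\<And>Q. ear B Q \<Longrightarrow> length P \<le> length Q"
  shows "card (nbrs (hd P) \<inter> set P) \<le> 1"
proof -
  obtain b b' where b: "P \<noteq> []" "successively E P" "set P \<subseteq> V - B" "b \<in> B" "b' \<in> B"
      "b \<noteq> b'" "E b (hd P)" "E (last P) b'"
    using P(1) unfolding ear_def by blast
  have "nbrs (hd P) \<inter> set P \<subseteq> {P ! 1}"
  proof
    fix x assume x: "x \<in> nbrs (hd P) \<inter> set P"
    then obtain i where i: "i < length P" "x = P ! i" by (auto simp: in_set_conv_nth)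
    have d: "successively E (drop i P)" "set (drop i P) \<subseteq> V - B"
      using b(2,3) set_drop_subset[of i P] by (metis append_take_drop_id successively_append_iff, blast)
    have "ear B (hd P # drop i P)"
    proof (rule earI[where b = b and b' = b'])
      show "successively E (hd P # drop i P)"
        using d i x by (auto simp: successively_Cons hd_drop_conv_nth nbrs_def)
      show "set (hd P # drop i P) \<subseteq> V - B" using d(2) b(1,3) hd_in_set[of P] by (simp add: subset_iff)
    qed (use b d i in auto)
    from P(2)[OF this] have "i \<le> 1" using i by simp
    moreover have "i \<noteq> 0" using x i b(1) E_irrefl by (auto simp: nbrs_def hd_conv_nth intro: gr0I)
    ultimately show "x \<in> {P ! 1}" using i by (simp add: le_Suc_eq)
  qed
  then show ?thesis using card_mono[of "{P ! 1}"] by simp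
qed

section \<open>Splicing a longest path into a path-star\<close>

text \<open>The part \<open>zs\<close> is what gets bypassed when a path leaves \<open>xs\<close>
  for \<open>q\<close> as late as possible. \<open>split_first_nbr\<close> is the mirror image, for
  entering a list from \<open>q\<close>.\<close>

lemma split_last_nbr:
  "\<exists>ys zs. xs = ys @ zs \<and> set zs \<inter> nbrs q = {} \<and> (ys = [] \<or> E (last ys) q)"
proof (induction xs rule: rev_induct)
  case (snoc x xs)
  show ?case
  proof (cases "E x q")
    case True
    then show ?thesis by (intro exI[of _ "xs @ [x]"] exI[of _ "[]"]) simp
  next
    case False
    obtain ys zs where "xs = ys @ zs" "set zs \<inter> nbrs q = {}" "ys = [] \<or> E (last ys) q"
      using snoc by blast
    then show ?thesis
      using False E_sym by (intro exI[of _ ys] exI[of _ "zs @ [x]"]) (auto simp: nbrs_def)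
  qed
qed simp

lemma split_first_nbr:
  "\<exists>ys zs. xs = ys @ zs \<and> set ys \<inter> nbrs q = {} \<and> (zs = [] \<or> E q (hd zs))"
proof (induction xs)
  case (Cons x xs)
  show ?case
  proof (cases "E q x")
    case True
    then show ?thesis by (intro exI[of _ "[]"] exI[of _ "x # xs"]) simp
  next
    case False
    obtain ys zs where "xs = ys @ zs" "set ys \<inter> nbrs q = {}" "zs = [] \<or> E q (hd zs)"
      using Cons by blast
    then show ?thesis
      using False by (intro exI[of _ "x # ys"] exI[of _ zs]) (auto simp: nbrs_def)
  qed
qed simp

lemma card_path_star_in:
  assumes "path_star_in m r W cs L" "r + 3 \<le> m"
  shows "card (set cs \<union> L) = m"
proof -
  have "card (set cs \<union> L) = length cs + card L"
    using assms(1) unfolding path_star_in_def path_in_def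
    by (subst card_Un_disjoint) (auto simp: distinct_card)
  then show ?thesis using assms by (simp add: path_star_in_def)
qed

text \<open>\<open>u\<close> and \<open>d\<close> are the parts of the old path before and after the
  gap. The forward splice bypasses \<open>u2\<close> and \<open>d1\<close>, the reversed one
  \<open>v2\<close> and \<open>e1\<close>. Regrouped by end of \<open>Q\<close>, \<open>u2\<close>
  and \<open>e1\<close> miss the neighbours of \<open>hd Q\<close>, while \<open>v2\<close> and
  \<open>d1\<close> miss those of \<open>last Q\<close>; each pair is therefore bounded by one of
  the last two hypotheses.\<close>

lemma splice_path:
  assumes Q: "path_in W Q" and ud: "distinct (u @ d)" "successively E u" "successively E d"
      "set (u @ d) \<subseteq> T" "T \<inter> W = {}" "finite T"
    and ends: "card (T - nbrs (hd Q)) + 2 \<le> length Q" "card (T - nbrs (last Q)) + 2 \<le> length Q"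
  shows "\<exists>Q' u1 u2 d1 d2. Q' \<in> {Q, rev Q} \<and> u = u1 @ u2 \<and> d = d1 @ d2 \<and>
    path_in (set (u @ d) \<union> W) (u1 @ Q' @ d2) \<and> length u + length d + 2 \<le> length (u1 @ Q' @ d2)"
proof -
  obtain u1 u2 where u: "u = u1 @ u2" "set u2 \<inter> nbrs (hd Q) = {}" "u1 = [] \<or> E (last u1) (hd Q)"
    using split_last_nbr by metis
  obtain v1 v2 where v: "u = v1 @ v2" "set v2 \<inter> nbrs (last Q) = {}" "v1 = [] \<or> E (last v1) (last Q)"
    using split_last_nbr by metis
  obtain d1 d2 where d: "d = d1 @ d2" "set d1 \<inter> nbrs (last Q) = {}" "d2 = [] \<or> E (last Q) (hd d2)"
    using split_first_nbr by metis
  obtain e1 e2 where e: "d = e1 @ e2" "set e1 \<inter> nbrs (hd Q) = {}" "e2 = [] \<or> E (hd Q) (hd e2)"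
    using split_first_nbr by metis
  have missed: "length xs + length ys \<le> card (T - nbrs q)"
    if "set xs \<inter> nbrs q = {}" "set ys \<inter> nbrs q = {}" "distinct (xs @ ys)" "set (xs @ ys) \<subseteq> T"
    for xs ys q
  proof -
    have "length xs + length ys = card (set (xs @ ys))"
      using that(3) distinct_card[of "xs @ ys"] by simp
    also have "\<dots> \<le> card (T - nbrs q)" using that ud(6) by (intro card_mono) auto
    finally show ?thesis .
  qed
  have "length u2 + length e1 \<le> card (T - nbrs (hd Q))"
    using u(2) e(2) ud(1,4) unfolding u(1) e(1) by (intro missed) auto
  moreover have "length v2 + length d1 \<le> card (T - nbrs (last Q))"
    using v(2) d(2) ud(1,4) unfolding v(1) d(1) by (intro missed) auto
  \<comment> \<open>The two splices together bypass at most \<open>2 (k - 2)\<close> vertices, so one bypasses at most \<open>k - 2\<close>.\<close>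
  ultimately consider "length u2 + length d1 + 2 \<le> length Q" | "length v2 + length e1 + 2 \<le> length Q"
    using ends by linarith
  then show ?thesis
  proof cases
    case 1
    have "path_in (set (u @ d) \<union> W) (u1 @ Q @ d2)"
      using Q u d ud unfolding path_in_def by (auto simp: successively_append_iff)
    moreover have "length u + length d + 2 \<le> length (u1 @ Q @ d2)" using 1 u d by simp
    ultimately show ?thesis using u(1) d(1) by blast
  next
    case 2
    have "path_in (set (u @ d) \<union> W) (v1 @ rev Q @ e2)"
      using Q v e ud unfolding path_in_def by (auto simp: successively_append_iff hd_rev last_rev)
    moreover have "length u + length d + 2 \<le> length (v1 @ rev Q @ e2)" using 2 v e by simp
    ultimately show ?thesis using v(1) e(1) by blast
  qed
qed

lemma path_star_in_avoiding:
  assumes H: "finite H" "r + 3 \<le> m" and ps: "path_star_in m r H cs L"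
    and A: "A \<subseteq> set cs \<union> L" "a \<in> A"
    and deg: "\<And>v. v \<in> H - A \<Longrightarrow> m + 1 \<le> card (nbrs v \<inter> H)"
    and ne: "H - (set cs \<union> L) \<noteq> {}"
  shows "\<exists>cs' L'. path_star_in m r (H - {a}) cs' L'"
proof -
  define T where "T = set cs \<union> L"
  define W where "W = H - T"
  have cs: "path_in H cs" "length cs = r + 2" "L \<subseteq> H - set cs" "L \<subseteq> nbrs (hd cs)" "finite L"
      "card L = m - r - 2"
    using ps by (auto simp: path_star_in_def)
  have T: "finite T" "T \<subseteq> H" "card T = m" "a \<in> T" "A \<subseteq> T"
    using cs A card_path_star_in[OF ps H(2)] by (auto simp: T_def path_in_def)
  have W: "finite W" "W \<noteq> {}" "W \<subseteq> H - A" "T \<inter> W = {}" "W \<subseteq> H - {a}" "H = T \<union> W"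
    using H ne T by (auto simp: W_def T_def)
  obtain Q where Q: "path_in W Q" "\<forall>Q'. path_in W Q' \<longrightarrow> length Q' \<le> length Q"
    using path_in_longest[OF W(1,2)] by metis
  \<comment> \<open>An end of \<open>Q\<close> has at least \<open>m + 1\<close> neighbours in
    \<open>H\<close> and at most \<open>length Q - 1\<close> of them in \<open>W\<close>, hence at
    least \<open>m + 2 - length Q\<close> among the \<open>m\<close> vertices of \<open>T\<close>.
    Avoiding \<open>a\<close> costs at most one neighbour.\<close>
  have end_deg: "card (T - nbrs (hd Q')) + 2 \<le> length Q \<and> m - 1 \<le> card (nbrs (hd Q') \<inter> (H - {a}))"
    if "Q' \<in> {Q, rev Q}" for Q'
  proof -
    have Q': "path_in W Q'" "\<forall>P. path_in W P \<longrightarrow> length P \<le> length Q'" "length Q' = length Q"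
      using that Q by (auto simp: path_in_rev)
    have "hd Q' \<in> H - A" using Q'(1) W(3) hd_in_set[of Q'] unfolding path_in_def by blast
    then have d: "m + 1 \<le> card (nbrs (hd Q') \<inter> H)" by (rule deg)
    have "card (nbrs (hd Q') \<inter> W) < length Q" using longest_path_card_nbrs[OF Q'(1,2)] Q'(3) by simp
    moreover have "card (nbrs (hd Q') \<inter> H) \<le> card (T \<inter> nbrs (hd Q')) + card (nbrs (hd Q') \<inter> W)"
      unfolding W(6) by (rule order.trans[OF card_mono card_Un_le]) auto
    moreover have "m = card (T \<inter> nbrs (hd Q')) + card (T - nbrs (hd Q'))"
      using card_Int_Diff[OF T(1), of "nbrs (hd Q')"] T(3) by simp
    moreover have "card (nbrs (hd Q') \<inter> H) \<le> card (insert a (nbrs (hd Q') \<inter> (H - {a})))"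
      by (rule card_mono) auto
    then have "card (nbrs (hd Q') \<inter> H) \<le> Suc (card (nbrs (hd Q') \<inter> (H - {a})))"
      by (simp add: card_insert_if split: if_splits)
    ultimately show ?thesis using d by linarith
  qed
  have fin: "finite (H - {a})" using H by simp
  \<comment> \<open>If \<open>a\<close> is a leaf, \<open>u\<close> is empty and \<open>d\<close> is
    the whole old path, which forces a new centre on \<open>Q\<close>. Otherwise the old path is cut
    at \<open>a\<close>, and a nonempty \<open>u\<close> still begins with the old centre.\<close>
  obtain u d where ud: "distinct (u @ d)" "successively E u" "successively E d"
      "set (u @ d) \<subseteq> T - {a}" "length u + length d \<ge> r + 1"
      "u \<noteq> [] \<Longrightarrow> hd u = hd cs \<and> a \<notin> L" "set (u @ d) \<subseteq> set cs"
  proof (cases "a \<in> L")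
    case True
    show ?thesis
      using that[of "[]" cs] True cs by (auto simp: path_in_def T_def)
  next
    case False
    then have "a \<in> set cs" using T by (auto simp: T_def)
    then obtain u d where split: "cs = u @ a # d" by (meson split_list)
    show ?thesis
    proof (rule that[of u d])
      show "set (u @ d) \<subseteq> T - {a}" using cs(1) by (auto simp: split path_in_def T_def)
    qed (use False cs(1,2) split in
        \<open>auto simp: path_in_def successively_append_iff successively_Cons\<close>)
  qed
  have "hd (rev Q) = last Q" using Q(1) by (simp add: path_in_def hd_rev)
  then have ends: "card (T - nbrs (hd Q)) + 2 \<le> length Q" "card (T - nbrs (last Q)) + 2 \<le> length Q"
    using end_deg[of Q] end_deg[of "rev Q"] by auto
  have udT: "set (u @ d) \<subseteq> T" using ud(4) by blast
  obtain Q' u1 u2 d1 d2 where N: "Q' \<in> {Q, rev Q}" "u = u1 @ u2" "d = d1 @ d2"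
      "path_in (set (u @ d) \<union> W) (u1 @ Q' @ d2)"
      "length u + length d + 2 \<le> length (u1 @ Q' @ d2)"
    using splice_path[OF Q(1) ud(1,2,3) udT W(4) T(1) ends] by blast
  define N' where "N' = u1 @ Q' @ d2"
  have N': "path_in (H - {a}) N'" "r + 2 \<le> length N'" "set N' \<subseteq> set cs \<union> W"
    using N(4,5) ud(4,5,7) W(5) T(2) unfolding N'_def[symmetric] path_in_def
    by (blast, linarith, blast)
  \<comment> \<open>If \<open>u1\<close> is empty, the new path starts at an end of
    \<open>Q\<close>, which has enough neighbours for new leaves. Otherwise it starts at the old
    centre, and the old leaves remain free because the path uses only vertices of \<open>cs\<close>
    and \<open>W\<close>.\<close>
  show ?thesis
  proof (cases "u1 = []")
    case True
    then have "hd N' = hd Q'" using N(1) Q(1) by (auto simp: N'_def path_in_def)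
    then show ?thesis
      using path_star_in_if_path[OF fin N'(1,2) H(2)] end_deg[OF N(1)] by simp
  next
    case False
    then have hd: "hd N' = hd cs" "a \<notin> L" using ud(6) N(2) by (auto simp: N'_def)
    have "set (take (r + 2) N') \<inter> L = {}"
      using N'(3) cs(3) set_take_subset[of "r + 2" N'] W(4) by (auto simp: T_def)
    then have "path_star_in m r (H - {a}) (take (r + 2) N') L"
      using N' cs hd by (auto simp: path_star_in_def intro: path_in_take)
    then show ?thesis by blast
  qed
qed

section \<open>The extremal argument\<close>

lemma conn_singleton: "conn {x}"
  unfolding conn_def by blast

lemma nonseparable_edge:
  assumes "E x y"
  shows "nonseparable {x, y}"
proof -
  have "conn ({x, y} - {z})" for z
  proof -
    have "x \<noteq> y" using assms E_irrefl by blast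
    then have "{x, y} - {z} \<in> {{x, y}, {x}, {y}}" by auto
    then show ?thesis
      using conn_singleton conn_insert[OF conn_singleton[of y] _ E_sym[OF assms]] by auto
  qed
  moreover have "conn {x, y}"
    using conn_insert[OF conn_singleton[of y] _ E_sym[OF assms]] by blast
  ultimately show ?thesis by (simp add: nonseparable_def)
qed

lemma path_star_in_mono: "path_star_in m r W cs L \<Longrightarrow> W \<subseteq> W' \<Longrightarrow> path_star_in m r W' cs L"
  by (auto simp: path_star_in_def path_in_def)

text \<open>The enlargement step: \<open>B\<close> absorbs either one vertex having two neighbours
  in \<open>B\<close> or, if there is none, a whole shortest ear.\<close>

lemma path_star_beside_larger_nonseparable:
  assumes V: "nonseparable V" "\<And>v. v \<in> V \<Longrightarrow> m + 2 \<le> card (nbrs v)" "r + 3 \<le> m"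
    and B: "nonseparable B" "2 \<le> card B" "B \<subseteq> V"
    and ps: "path_star_in m r (V - B) cs L"
    and ne: "V - B - (set cs \<union> L) \<noteq> {}"
  shows "\<exists>B' cs' L'. nonseparable B' \<and> B \<subset> B' \<and> B' \<subseteq> V \<and> path_star_in m r (V - B') cs' L'"
proof -
  define H where "H = V - B"
  define A where "A = {v \<in> H. 2 \<le> card (nbrs v \<inter> B)}"
  have finH: "finite H" using finite_V by (simp add: H_def)
  have nb: "nbrs v \<subseteq> V" for v by (auto simp: nbrs_def E_V)
  have card_split: "card (nbrs v) = card (nbrs v \<inter> S) + card (nbrs v \<inter> (V - S))" for v S
  proof -
    have "nbrs v - S = nbrs v \<inter> (V - S)" using nb[of v] by blast
    then show ?thesis using card_Int_Diff[OF finite_nbrs, of v S] by simp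
  qed
  \<comment> \<open>A vertex with two neighbours in \<open>B\<close> is by itself an ear.\<close>
  have earA: "ear B [a]" if a: "a \<in> A" for a
  proof -
    have "2 \<le> card (nbrs a \<inter> B)" using a by (simp add: A_def)
    then obtain b b' where "b \<in> nbrs a \<inter> B" "b' \<in> nbrs a \<inter> B" "b \<noteq> b'"
      by (auto simp: card_le_Suc_iff numeral_2_eq_2)
    then show ?thesis
      using a E_sym by (intro earI[where b = b and b' = b']) (auto simp: nbrs_def A_def H_def)
  qed
  show ?thesis
  proof (cases "A = {}")
    case False
    have "\<exists>a\<in>A. \<exists>cs' L'. path_star_in m r (H - {a}) cs' L'"
    proof (cases "A \<subseteq> set cs \<union> L")
      case True
      obtain a where a: "a \<in> A" using False by blast
      \<comment> \<open>Outside \<open>A\<close>, at most one of the \<open>m + 2\<close> neighbours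
        is lost to \<open>B\<close>.\<close>
      have deg: "m + 1 \<le> card (nbrs v \<inter> H)" if "v \<in> H - A" for v
        using that card_split[of v B] V(2)[of v] by (auto simp: A_def H_def)
      have "H - (set cs \<union> L) \<noteq> {}" using ne by (simp add: H_def)
      with path_star_in_avoiding[OF finH V(3) ps[folded H_def] True a deg] a show ?thesis by blast
    next
      case False
      then obtain a where "a \<in> A" "a \<notin> set cs \<union> L" by blast
      moreover from this have "path_star_in m r (H - {a}) cs L"
        using ps by (auto simp: path_star_in_def path_in_def H_def)
      ultimately show ?thesis by blast
    qed
    then obtain a cs' L' where a: "a \<in> A" "path_star_in m r (H - {a}) cs' L'" by blast
    moreover have "nonseparable (B \<union> {a})" using nonseparable_ear[OF B(1) earA[OF a(1)]] by simp
    moreover have "H - {a} = V - (B \<union> {a})" by (auto simp: H_def)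
    moreover have "B \<subset> B \<union> {a}" "B \<union> {a} \<subseteq> V" using a B by (auto simp: A_def H_def)
    ultimately show ?thesis by metis
  next
    case True
    have "B \<noteq> V" using ne by blast
    then obtain P where P: "ear B P" "\<And>Q. ear B Q \<Longrightarrow> length P \<le> length Q"
      using ear_exists[OF V(1) B(3) _ B(2)] ex_has_least_nat[of "ear B" _ length] by metis
    have PH: "P \<noteq> []" "set P \<subseteq> H" using P(1) by (auto simp: ear_def H_def)
    have few: "card (nbrs v \<inter> B) \<le> 1" if "v \<in> H" for v using that True by (force simp: A_def)
    \<comment> \<open>At most three of the \<open>m + 2\<close> neighbours lie in \<open>B\<close>
      or on the ear.\<close>
    have deg: "m - 1 \<le> card (nbrs v \<inter> (V - (B \<union> set P)))" if "v \<in> V - (B \<union> set P)" for v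
      using shortest_ear_nbrs[OF P, of v] few[of v] that V(2)[of v] card_split[of v "B \<union> set P"]
      by (auto simp: H_def)
    \<comment> \<open>Otherwise \<open>hd P\<close> would have at most two neighbours, one in
      \<open>B\<close> and one on the ear.\<close>
    have "V - (B \<union> set P) \<noteq> {}"
    proof
      assume "V - (B \<union> set P) = {}"
      then have "card (nbrs (hd P)) \<le> card (nbrs (hd P) \<inter> B) + card (nbrs (hd P) \<inter> set P)"
        using card_split[of "hd P" "B \<union> set P"] card_Un_le[of "nbrs (hd P) \<inter> B" "nbrs (hd P) \<inter> set P"]
        by (simp only: Int_Un_distrib) simp
      moreover have "hd P \<in> H" using PH by auto
      ultimately show False
        using few[of "hd P"] shortest_ear_hd_nbrs[OF P] V(2)[of "hd P"] V(3) by (simp add: H_def)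
    qed
    then obtain cs' L' where "path_star_in m r (V - (B \<union> set P)) cs' L'"
      using path_star_in_if_min_degree[OF _ _ V(3) deg] finite_V by blast
    moreover have "nonseparable (B \<union> set P)"
      using nonseparable_ear[OF B(1) P(1)] shortest_ear_distinct[OF P] by blast
    moreover have "B \<subset> B \<union> set P" using PH by (cases P) (auto simp: H_def)
    ultimately show ?thesis using PH B by (metis H_def Diff_subset Un_least order.trans)
  qed
qed

text \<open>For a triple with \<open>B\<close> of maximum size, the enlargement step rules out
  leftover vertices, so \<open>B\<close> is exactly the complement of the path-star.\<close>

lemma nonseparable_path_star_complement:
  assumes V: "V \<noteq> {}" "nonseparable V" "\<And>v. v \<in> V \<Longrightarrow> m + 2 \<le> card (nbrs v)" "r + 3 \<le> m"
  shows "\<exists>cs L. path_star_in m r V cs L \<and> nonseparable (V - (set cs \<union> L))"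
proof -
  have nb: "nbrs v \<subseteq> V" for v by (auto simp: nbrs_def E_V)
  define good where "good = (\<lambda>(B, cs, L). nonseparable B \<and> 2 \<le> card B \<and> B \<subseteq> V \<and>
    path_star_in m r (V - B) cs L)"
  have "\<exists>t. good t"
  proof -
    obtain x where x: "x \<in> V" using V(1) by blast
    then have "nbrs x \<noteq> {}" using V(3)[OF x] by auto
    then obtain y where y: "E x y" by (auto simp: nbrs_def)
    have xy: "x \<noteq> y" "{x, y} \<subseteq> V" using y E_irrefl E_V x by auto
    \<comment> \<open>The first triple takes an edge as \<open>B\<close>; removing its two ends
      lowers every degree by at most two.\<close>
    have deg: "m \<le> card (nbrs v \<inter> (V - {x, y}))" if "v \<in> V" for v
    proof -
      have "card (nbrs v) \<le> card (nbrs v \<inter> (V - {x, y})) + card {x, y}"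
        using nb[of v] by (intro order.trans[OF card_mono card_Un_le]) auto
      then show ?thesis using V(3)[OF that] xy by simp
    qed
    have "V - {x, y} \<noteq> {}" using deg[OF x] V(4) by force
    moreover have "m - 1 \<le> card (nbrs v \<inter> (V - {x, y}))" if "v \<in> V - {x, y}" for v
      using deg[of v] that by auto
    ultimately obtain cs L where "path_star_in m r (V - {x, y}) cs L"
      using path_star_in_if_min_degree[of "V - {x, y}", OF _ _ V(4)] finite_V by blast
    then have "good ({x, y}, cs, L)" using nonseparable_edge[OF y] xy by (simp add: good_def)
    then show ?thesis ..
  qed
  moreover have "card (fst t) < Suc (card V)" if "good t" for t
    using that finite_V by (auto simp: good_def less_Suc_eq_le intro: card_mono)
  ultimately obtain t where t: "good t" "\<forall>t'. good t' \<longrightarrow> card (fst t') \<le> card (fst t)"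
    using ex_has_greatest_nat[of good _ "\<lambda>t. card (fst t)"] by metis
  obtain B cs L where BcL: "t = (B, cs, L)" by (cases t)
  have B: "nonseparable B" "2 \<le> card B" "B \<subseteq> V" "path_star_in m r (V - B) cs L"
    using t(1) by (auto simp: BcL good_def)
  have "V - B - (set cs \<union> L) = {}"
  proof (rule ccontr)
    assume "\<not> ?thesis"
    then obtain B' cs' L' where B': "nonseparable B'" "B \<subset> B'" "B' \<subseteq> V"
        "path_star_in m r (V - B') cs' L'"
      using path_star_beside_larger_nonseparable[OF V(2,3,4) B] by blast
    have "card B < card B'" using B' finite_V by (meson finite_subset psubset_card_mono)
    moreover from this have "good (B', cs', L')" using B B' by (simp add: good_def)
    ultimately show False using t(2) by (force simp: BcL)
  qed
  moreover have "set cs \<union> L \<subseteq> V - B" using B(4) by (auto simp: path_star_in_def path_in_def)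
  ultimately have "V - (set cs \<union> L) = B" using B(3) by blast
  then show ?thesis using B path_star_in_mono[OF B(4)] by auto
qed

end

section \<open>Embedded copies as subgraphs\<close>

text \<open>For each arc of \<open>K\<close> an arc of \<open>G\<close> between the image vertices
  is chosen. The choice is injective because \<open>K\<close> has no parallel arcs, so it completes
  \<open>g\<close> to a digraph isomorphism onto its image. Keeping the head and tail maps of
  \<open>G\<close> makes the image compatible with \<open>G\<close>.\<close>

lemma subgraph_digraph_iso_if_embedding:
  assumes K: "nomulti_digraph K" and "wf_digraph G"
    and g: "inj_on g (verts K)" "g ` verts K \<subseteq> verts G"
    and adj: "\<And>a. a \<in> arcs K \<Longrightarrow> g (tail K a) \<rightarrow>\<^bsub>G\<^esub> g (head K a)"
  shows "\<exists>T. subgraph T G \<and> digraph_iso T K \<and> verts T = g ` verts K"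
proof -
  interpret K: nomulti_digraph K by (rule K)
  have "\<exists>\<phi>. \<forall>a\<in>arcs K. \<phi> a \<in> arcs G \<and> tail G (\<phi> a) = g (tail K a) \<and> head G (\<phi> a) = g (head K a)"
    using adj by (intro bchoice) (metis reachableE)
  then obtain \<phi> where \<phi>: "\<And>a. a \<in> arcs K \<Longrightarrow> \<phi> a \<in> arcs G"
      "\<And>a. a \<in> arcs K \<Longrightarrow> tail G (\<phi> a) = g (tail K a)"
      "\<And>a. a \<in> arcs K \<Longrightarrow> head G (\<phi> a) = g (head K a)"
    by blast
  define hom where "hom = \<lparr>iso_verts = g, iso_arcs = \<phi>, iso_head = head G, iso_tail = tail G\<rparr>"
  define T where "T = app_iso hom K"
  have "inj_on \<phi> (arcs K)"
  proof (rule inj_onI)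
    fix a b assume ab: "a \<in> arcs K" "b \<in> arcs K" "\<phi> a = \<phi> b"
    then have "g (tail K a) = g (tail K b)" "g (head K a) = g (head K b)"
      using \<phi>(2,3) by metis+
    then have "tail K a = tail K b" "head K a = head K b"
      using ab by (auto dest: inj_onD[OF g(1)])
    then show "a = b" using ab K.no_multi_arcs by (simp add: arc_to_ends_def)
  qed
  then have iso: "K.digraph_isomorphism hom"
    using g(1) \<phi> by (auto simp: K.digraph_isomorphism_def hom_def K.wf_digraph)
  then have "digraph_iso K T" unfolding digraph_iso_def T_def by blast
  then have "digraph_iso T K" by (rule digraph_iso_swap[OF K.wf_digraph])
  moreover have "wf_digraph T"
    unfolding T_def wf_digraph_def using \<phi>(2,3) by (auto simp: hom_def)
  then have "subgraph T G"
    unfolding subgraph_def compatible_def using g(2) \<phi>(1) assms(2)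
    by (auto simp: T_def hom_def)
  moreover have "verts T = g ` verts K" by (simp add: T_def hom_def)
  ultimately show ?thesis by blast
qed

section \<open>Transfer between digraphs and adjacency relations\<close>

context graph
begin

interpretation adj: simple_adjacency "verts G" "dominates G"
proof
  show "finite (verts G)" by simp
  show "y \<rightarrow> x" if "x \<rightarrow> y" for x y using that sym_arcs by (rule arcs_ends_symmetric[rotated])
  show "\<not> x \<rightarrow> x" for x using adj_not_same by blast
  show "y \<in> verts G" if "x \<rightarrow> y" for x y using that by (rule adj_in_verts)
qed

lemma arcs_ends_induce_subgraph:
  "arcs_ends (G \<restriction> W) = arcs_ends G \<inter> W \<times> W"
  by (auto simp: arcs_ends_conv)

text \<open>A walk from \<open>X\<close> to its complement in \<open>W\<close> must cross the cut;
  conversely, no arc of the induced subgraph leaves the set reachable from \<open>u\<close>.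
  Nonemptiness appears because \<open>connected\<close> excludes the empty graph, unlike
  \<open>conn\<close>.\<close>

lemma connected_induce_subgraph_iff:
  assumes "W \<subseteq> verts G"
  shows "connected (G \<restriction> W) \<longleftrightarrow> W \<noteq> {} \<and> adj.conn W"
proof -
  interpret W: wf_digraph "G \<restriction> W" by (rule wellformed_induce_subgraph)
  have "(arcs_ends (G \<restriction> W))\<^sup>s = arcs_ends (G \<restriction> W)"
    using adj.E_sym by (auto simp: symcl_def arcs_ends_induce_subgraph)
  then have conv: "connected (G \<restriction> W) \<longleftrightarrow> W \<noteq> {} \<and> (\<forall>u\<in>W. \<forall>v\<in>W. u \<rightarrow>\<^sup>*\<^bsub>G \<restriction> W\<^esub> v)"
    by (simp add: connected_conv reachable_def)
  have "(\<forall>u\<in>W. \<forall>v\<in>W. u \<rightarrow>\<^sup>*\<^bsub>G \<restriction> W\<^esub> v) \<longleftrightarrow> adj.conn W"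
  proof
    assume reach: "\<forall>u\<in>W. \<forall>v\<in>W. u \<rightarrow>\<^sup>*\<^bsub>G \<restriction> W\<^esub> v"
    show "adj.conn W"
      unfolding adj.conn_def
    proof (intro allI impI, rule ccontr)
      fix X assume X: "X \<subseteq> W" "X \<noteq> {}" "X \<noteq> W" "\<not> (\<exists>x\<in>X. \<exists>y\<in>W - X. x \<rightarrow> y)"
      then obtain x y where xy: "x \<in> X" "y \<in> W - X" by blast
      then have "x \<rightarrow>\<^sup>*\<^bsub>G \<restriction> W\<^esub> y" using reach X by blast
      then have "y \<in> X"
        using X(4) xy(1)
        by (induction rule: W.reachable_induct) (auto simp: arcs_ends_induce_subgraph)
      then show False using xy by blast
    qed
  next
    assume conn: "adj.conn W"
    show "\<forall>u\<in>W. \<forall>v\<in>W. u \<rightarrow>\<^sup>*\<^bsub>G \<restriction> W\<^esub> v"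
    proof
      fix u assume u: "u \<in> W"
      define X where "X = {v. u \<rightarrow>\<^sup>*\<^bsub>G \<restriction> W\<^esub> v}"
      have "u \<in> X" using u by (simp add: X_def)
      moreover have XW: "X \<subseteq> W" using W.reachable_in_verts(2) by (auto simp: X_def)
      moreover have "\<not> (\<exists>x\<in>X. \<exists>y\<in>W - X. x \<rightarrow> y)"
      proof
        assume "\<exists>x\<in>X. \<exists>y\<in>W - X. x \<rightarrow> y"
        then obtain x y where xy: "x \<in> X" "y \<in> W - X" "x \<rightarrow> y" by blast
        then have "x \<rightarrow>\<^bsub>G \<restriction> W\<^esub> y" using XW by (auto simp: arcs_ends_induce_subgraph)
        then have "y \<in> X" using xy(1) W.reachable_adj_trans by (auto simp: X_def)
        then show False using xy(2) by blast
      qed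
      ultimately have "X = W" using conn unfolding adj.conn_def by blast
      then show "\<forall>v\<in>W. u \<rightarrow>\<^sup>*\<^bsub>G \<restriction> W\<^esub> v" by (auto simp: X_def)
    qed
  qed
  with conv show ?thesis by simp
qed

text \<open>Connectivity at least 2 means that no set of size 0 or 1 is a cut. The clause about at
  most one remaining vertex, applied to singletons, accounts for
  \<open>3 \<le> card W\<close>.\<close>

lemma two_connected_induce_subgraph_iff:
  assumes "W \<subseteq> verts G"
  shows "two_connected (G \<restriction> W) \<longleftrightarrow> 3 \<le> card W \<and> adj.nonseparable W"
proof -
  have finW: "finite W" using assms by (rule finite_subset) simp
  have restr: "(G \<restriction> W) \<restriction> (W - S) = G \<restriction> (W - S)" for S
    by (auto simp: induce_subgraph_def)
  define cut where "cut S \<longleftrightarrow> \<not> connected (G \<restriction> (W - S)) \<or> card (W - S) \<le> 1" for S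
  have cut_iff: "cut S \<longleftrightarrow> \<not> adj.conn (W - S) \<or> card (W - S) \<le> 1" for S
  proof -
    have "W - S \<subseteq> verts G" using assms by blast
    then have "cut S \<longleftrightarrow> \<not> (W - S \<noteq> {} \<and> adj.conn (W - S)) \<or> card (W - S) \<le> 1"
      unfolding cut_def by (simp only: connected_induce_subgraph_iff)
    moreover have "card (W - S) \<le> 1" if "W - S = {}" unfolding that by simp
    ultimately show ?thesis by blast
  qed
  define K where "K k \<longleftrightarrow> (\<exists>S \<subseteq> W. card S = k \<and> cut S)" for k
  have vc: "vertex_connectivity (G \<restriction> W) = (LEAST k. K k)"
    by (simp add: vertex_connectivity_def restr K_def cut_def)
  \<comment> \<open>\<open>W\<close> itself is a cut, so the \<open>LEAST\<close> is
    attained.\<close>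
  have "K (card W)" unfolding K_def cut_iff by (intro exI[of _ W]) simp
  then have "two_connected (G \<restriction> W) \<longleftrightarrow> (\<forall>k<2. \<not> K k)"
    unfolding two_connected_def vc by (metis LeastI not_less not_less_Least order_less_le_trans)
  also have "\<dots> \<longleftrightarrow> \<not> K 0 \<and> \<not> K 1" by (auto simp: less_2_cases_iff)
  also have "\<dots> \<longleftrightarrow> \<not> cut {} \<and> (\<forall>x\<in>W. \<not> cut {x})"
  proof -
    have "K 0 \<longleftrightarrow> cut {}" using finW by (auto simp: K_def dest: finite_subset)
    moreover have "K 1 \<longleftrightarrow> (\<exists>x\<in>W. cut {x})" by (auto simp: K_def card_1_singleton_iff)
    ultimately show ?thesis by blast
  qed
  also have "\<dots> \<longleftrightarrow> 3 \<le> card W \<and> adj.nonseparable W"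
  proof
    assume *: "\<not> cut {} \<and> (\<forall>x\<in>W. \<not> cut {x})"
    then obtain x where x: "x \<in> W" by (force simp: cut_iff)
    then have "2 \<le> card (W - {x})" using * by (auto simp: cut_iff)
    then have "3 \<le> card W" using x finW by (simp add: card_Diff_singleton)
    moreover have "adj.conn (W - {y})" for y using * by (cases "y \<in> W") (auto simp: cut_iff)
    ultimately show "3 \<le> card W \<and> adj.nonseparable W"
      using * by (auto simp: adj.nonseparable_def cut_iff)
  next
    assume "3 \<le> card W \<and> adj.nonseparable W"
    then show "\<not> cut {} \<and> (\<forall>x\<in>W. \<not> cut {x})"
      using finW by (auto simp: adj.nonseparable_def cut_iff)
  qed
  finally show ?thesis .
qed

lemma out_degree_eq_card_nbrs: "out_degree G v = card (adj.nbrs v)"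
proof -
  have "bij_betw (head G) (out_arcs G v) (adj.nbrs v)"
    unfolding bij_betw_def
  proof
    show "inj_on (head G) (out_arcs G v)"
      by (rule inj_onI) (auto intro: no_multi_arcs simp: arc_to_ends_def)
    show "head G ` out_arcs G v = adj.nbrs v"
      unfolding adj.nbrs_def by (auto simp: arcs_ends_conv image_iff)
  qed
  then show ?thesis unfolding out_degree_def by (rule bij_betw_same_card)
qed

lemma path_star_subgraph:
  assumes ps: "adj.path_star_in m r (verts G) cs L" and "r + 3 \<le> m"
  shows "\<exists>T. subgraph T G \<and> digraph_iso T (path_star r (m - r)) \<and> verts T = set cs \<union> L"
proof -
  have cs: "distinct cs" "successively (dominates G) cs" "length cs = r + 2" "set cs \<subseteq> verts G"
      "L \<subseteq> verts G - set cs" "L \<subseteq> adj.nbrs (hd cs)" "finite L" "card L = m - r - 2"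
    using ps by (auto simp: adj.path_star_in_def adj.path_in_def)
  have "card {r + 2..<m} = card L" using cs(8) by simp
  then obtain h where h: "bij_betw h {r + 2..<m} L"
    using cs(7) by (meson finite_atLeastLessThan finite_same_card_bij)
  \<comment> \<open>\<open>cs\<close> starts at the centre, which is vertex \<open>r + 1\<close> of
    the path-star, so it is read backwards. The leaf \<open>r\<close> lies on the path, and
    \<open>h\<close> supplies the remaining \<open>m - r - 2\<close> leaves.\<close>
  define g where "g i = (if i \<le> r + 1 then cs ! (r + 1 - i) else h i)" for i
  have verts: "verts (path_star r (m - r)) = {..<m}"
    using verts_path_star[of "m - r" r] assms(2) by simp
  have low: "bij_betw g {..r + 1} (set cs)"
  proof -
    have "bij_betw (\<lambda>i. r + 1 - i) {..r + 1} {..<r + 2}"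
      by (rule bij_betw_byWitness[where f' = "\<lambda>i. r + 1 - i"]) auto
    from bij_betw_trans[OF this bij_betw_nth[OF cs(1)]]
    have "bij_betw ((!) cs \<circ> (\<lambda>i. r + 1 - i)) {..r + 1} (set cs)" using cs(3) by simp
    then show ?thesis by (rule bij_betw_cong[THEN iffD1, rotated]) (simp add: g_def)
  qed
  have high: "bij_betw g {r + 2..<m} L"
    using h by (rule bij_betw_cong[THEN iffD1, rotated]) (simp add: g_def)
  have "bij_betw g ({..r + 1} \<union> {r + 2..<m}) (set cs \<union> L)"
    using low high cs(5) by (intro bij_betw_combine) auto
  moreover have "{..r + 1} \<union> {r + 2..<m} = {..<m}" using assms(2) by auto
  ultimately have g: "bij_betw g {..<m} (set cs \<union> L)" by simp
  have path: "g i \<rightarrow> g (Suc i)" if "i \<le> r" for i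
  proof -
    have "cs ! (r - i) \<rightarrow> cs ! Suc (r - i)"
      using cs(3) by (intro successively_nth[OF cs(2)]) simp
    moreover have "g (Suc i) = cs ! (r - i)" "g i = cs ! Suc (r - i)"
      using that by (auto simp: g_def Suc_diff_le)
    ultimately show ?thesis using adj.E_sym by simp
  qed
  have centre: "g (r + 1) = hd cs" using cs(3) by (cases cs) (auto simp: g_def)
  have leaf: "g (r + 1) \<rightarrow> g i" if "r + 2 \<le> i" "i < m" for i
  proof -
    have "g i \<in> L" using high that by (auto simp: bij_betw_def)
    then show ?thesis unfolding centre using cs(6) by (auto simp: adj.nbrs_def)
  qed
  have star: "g (Suc r) \<rightarrow> g i" if "r \<le> i" "i < m" "i \<noteq> r + 1" for i
    using that path[of r] leaf[of i] adj.E_sym by (cases "i = r") auto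
  have "\<exists>T. subgraph T G \<and> digraph_iso T (path_star r (m - r)) \<and>
      verts T = g ` verts (path_star r (m - r))"
  proof (rule subgraph_digraph_iso_if_embedding)
    show "nomulti_digraph (path_star r (m - r))"
      using graph_path_star unfolding graph_def digraph_def by blast
    show "wf_digraph G" by unfold_locales
    show "inj_on g (verts (path_star r (m - r)))" using g verts by (simp add: bij_betw_def)
    show "g ` verts (path_star r (m - r)) \<subseteq> verts G"
      using g cs(4,5) verts by (auto simp: bij_betw_def)
    fix a assume "a \<in> arcs (path_star r (m - r))"
    then have "(\<exists>i<r. a = (i, Suc i) \<or> a = (Suc i, i)) \<or>
        (\<exists>i\<in>{r..<m} - {r + 1}. a = (Suc r, i) \<or> a = (i, Suc r))"
      using assms(2) by (auto simp: path_star_def path_graph_def star_graph_def)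
    then consider i where "i < r" "a = (i, Suc i) \<or> a = (Suc i, i)"
      | i where "r \<le> i" "i < m" "i \<noteq> r + 1" "a = (Suc r, i) \<or> a = (i, Suc r)"
      by (metis DiffE atLeastLessThan_iff singletonI)
    then have "g (fst a) \<rightarrow> g (snd a)"
    proof cases
      case 1
      then show ?thesis using path[of i] adj.E_sym[OF path[of i]] by auto
    next
      case 2
      then show ?thesis using star[of i] adj.E_sym[OF star[of i]] by auto
    qed
    then show "g (tail (path_star r (m - r)) a) \<rightarrow> g (head (path_star r (m - r)) a)"
      by (simp add: path_star_def)
  qed
  then show ?thesis using g verts by (simp add: bij_betw_def)
qed

text \<open>The degree bound gives at least \<open>m + 3\<close> vertices, so at least three survive
  the removal of the path-star, and nonseparability then amounts to 2-connectivity.\<close>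

lemma nonseparating_path_star:
  assumes "r + 3 \<le> m" "two_connected G" "min_degree G \<ge> m + 2"
  shows "\<exists>T. subgraph T G \<and> digraph_iso T (path_star r (m - r)) \<and>
    two_connected (G \<restriction> (verts G - verts T))"
proof -
  have "G \<restriction> verts G = G"
    by (rule pre_digraph.equality) (auto simp: induce_subgraph_def)
  then have V: "3 \<le> card (verts G)" "adj.nonseparable (verts G)"
    using two_connected_induce_subgraph_iff[of "verts G"] assms(2) by auto
  have deg: "m + 2 \<le> card (adj.nbrs v)" if "v \<in> verts G" for v
  proof -
    have "min_degree G \<le> out_degree G v" unfolding min_degree_def using that by simp
    then show ?thesis using assms(3) by (simp add: out_degree_eq_card_nbrs)
  qed
  have ne: "verts G \<noteq> {}" using V(1) by auto
  obtain cs L where ps: "adj.path_star_in m r (verts G) cs L"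
      "adj.nonseparable (verts G - (set cs \<union> L))"
    using adj.nonseparable_path_star_complement[OF ne V(2) deg assms(1)] by blast
  have sub: "set cs \<union> L \<subseteq> verts G"
    using ps(1) by (auto simp: adj.path_star_in_def adj.path_in_def)
  obtain v where v: "v \<in> verts G" using ne by blast
  have "insert v (adj.nbrs v) \<subseteq> verts G" using v by (auto simp: adj.nbrs_def adj.E_V)
  moreover have "v \<notin> adj.nbrs v" by (simp add: adj.nbrs_def adj.E_irrefl)
  ultimately have "m + 3 \<le> card (verts G)"
    using deg[OF v] card_mono[OF finite_verts, of "insert v (adj.nbrs v)"] by simp
  then have "3 \<le> card (verts G - (set cs \<union> L))"
    using card_Diff_subset[OF finite_subset[OF sub finite_verts] sub]
      adj.card_path_star_in[OF ps(1) assms(1)] by simp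
  then have "two_connected (G \<restriction> (verts G - (set cs \<union> L)))"
    using two_connected_induce_subgraph_iff[of "verts G - (set cs \<union> L)"] ps(2) by blast
  then show ?thesis using path_star_subgraph[OF ps(1) assms(1)] by metis
qed

end

theorem theorem3p3:
  fixes G :: "('a, 'b) pre_digraph" and m r :: nat
  assumes "1 \<le> r" and "r + 3 \<le> m"
    and "graph G" and "two_connected G" and "min_degree G \<ge> m + 2"
  shows "\<exists>T. subgraph T G \<and> digraph_iso T (path_star r (m - r)) \<and>
             two_connected (G \<restriction> (verts G - verts T))"
  using graph.nonseparating_path_star assms by blast

end
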